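(* Any poloid is isomorphic to a transformation poloid; that is, for every poloid $P$ there are a non-empty set $X$, a transformation poloid $\mathscr{P}_X$ on $X$ and a poloid isomorphism $P\to\mathscr{P}_X$.
   Context: A (partial) magma is a non-empty set $P$ with a partial binary operation $(x,y)\mapsto xy$, i.e. a function from some non-empty subset of $P\times P$ to $P$; "$xy$ is defined" means that $(x,y)$ lies in that subset. A compound expression is defined when all its successive products are: $(xy)z$ is defined iff $xy$ is defined and the product of $xy$ with $z$ is defined; similarly for $x(yz)$. A semigroupoid is a magma $P$ such that for all $x,y,z\in P$: if (a) $xy$ and $yz$ are both defined, or (b) $x(yz)$ is defined, or (c) $(xy)z$ is defined, then $(xy)z$ and $x(yz)$ are both defined and $(xy)z=x(yz)$. A unit in a magma $P$ is an $e\in P$ such that $ex=x$ for all $x$ for which $ex$ is defined and $xe=x$ for all $x$ for which $xe$ is defined. A poloid is a semigroupoid $P$ such that for every $x\in P$ there are units $\epsilon_x,\varepsilon_x\in P$ such that $\epsilon_x x$ and $x\varepsilon_x$ are defined. A transformation $f$ on a set $X$ consists of a subset $\mathrm{dom}(f)\subseteq X$, a rule assigning to each $x\in\mathrm{dom}(f)$ exactly one $f(x)\in X$, and a subset $\mathrm{cod}(f)\subseteq X$ with $\mathrm{im}(f)=\{f(x)\mid x\in\mathrm{dom}(f)\}\subseteq\mathrm{cod}(f)$. Two transformations are equal iff they have the same domain, codomain and values. It is non-empty if $\mathrm{dom}(f)\neq\emptyset$. For $S\subseteq X$, the identity transformation $Id_S$ has $\mathrm{dom}(Id_S)=\mathrm{cod}(Id_S)=S$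 and $Id_S(x)=x$ for $x\in S$. A transformation magma on $X$ is a set $\mathscr{F}_X$ of non-empty transformations on $X$ that is a magma under the partial operation $\circ$, where $f\circ g$ is defined iff $\mathrm{dom}(f)\supseteq\mathrm{im}(g)$, and then $\mathrm{dom}(f\circ g)=\mathrm{dom}(g)$, $\mathrm{cod}(f\circ g)=\mathrm{cod}(f)$, $(f\circ g)(x)=f(g(x))$ for $x\in\mathrm{dom}(g)$ (in particular, $f\circ g\in\mathscr{F}_X$ whenever $f,g\in\mathscr{F}_X$ and $f\circ g$ is defined). A transformation semigroupoid on $X$ is a transformation magma $\mathscr{F}_X$ on $X$ such that for all $f,g\in\mathscr{F}_X$, if $\mathrm{dom}(f)\supseteq\mathrm{im}(g)$ then $\mathrm{dom}(f)=\mathrm{cod}(g)$. A transformation poloid on $X$ is a transformation semigroupoid $\mathscr{S}_X$ on $X$ such that if $f\in\mathscr{S}_X$ then $Id_{\mathrm{dom}(f)},Id_{\mathrm{cod}(f)}\in\mathscr{S}_X$. (Every transformation poloid is a poloid under $\circ$.) A poloid homomorphism from a poloid $P$ to a poloid $Q$ is a total function $\phi:P\to Q$ such that (1) if $xy$ is defined then $\phi(x)\phi(y)$ is defined and $\phi(xy)=\phi(x)\phi(y)$; (2) if $e$ is a unit in $P$ then $\phi(e)$ is a unit in $Q$. A poloid isomorphism is a poloid homomorphism whose inverse function exists and is a poloid homomorphism. *)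

theory Defs
  imports Main
begin

text \<open>
  A partial binary operation on \<open>P\<close> is a function \<open>m\<close> with values in an option type:
  \<open>m x y = Some z\<close> says that \<open>xy\<close> is defined and equal to \<open>z\<close>, and \<open>m x y = None\<close> that it is
  not defined. Nothing is defined outside \<open>P\<close>.
\<close>

locale partial_magma =
  fixes P :: "'a set" and m :: "'a \<Rightarrow> 'a \<Rightarrow> 'a option"
  assumes carrier_nonempty: "P \<noteq> {}"
    and m_closed: "\<And>x y z. m x y = Some z \<Longrightarrow> x \<in> P \<and> y \<in> P \<and> z \<in> P"
    and m_nonempty: "\<exists>x y. m x y \<noteq> None"
begin

definition left_assoc :: "'a \<Rightarrow> 'a \<Rightarrow> 'a \<Rightarrow> 'a option" where
  "left_assoc x y z = Option.bind (m x y) (\<lambda>u. m u z)"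

definition right_assoc :: "'a \<Rightarrow> 'a \<Rightarrow> 'a \<Rightarrow> 'a option" where
  "right_assoc x y z = Option.bind (m y z) (\<lambda>u. m x u)"

definition is_unit_elem :: "'a \<Rightarrow> bool" where
  "is_unit_elem e \<longleftrightarrow> e \<in> P
     \<and> (\<forall>x\<in>P. m e x \<noteq> None \<longrightarrow> m e x = Some x)
     \<and> (\<forall>x\<in>P. m x e \<noteq> None \<longrightarrow> m x e = Some x)"

end

locale semigroupoid = partial_magma +
  assumes semigroupoid_assoc:
    "\<And>x y z. \<lbrakk>x \<in> P; y \<in> P; z \<in> P;
       (m x y \<noteq> None \<and> m y z \<noteq> None) \<or> right_assoc x y z \<noteq> None \<or> left_assoc x y z \<noteq> None\<rbrakk>
     \<Longrightarrow> left_assoc x y z \<noteq> None \<and> right_assoc x y z \<noteq> None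
         \<and> left_assoc x y z = right_assoc x y z"

locale poloid = semigroupoid +
  assumes poloid_units:
    "\<And>x. x \<in> P \<Longrightarrow>
       \<exists>e e'. is_unit_elem e \<and> is_unit_elem e' \<and> m e x \<noteq> None \<and> m x e' \<noteq> None"

locale poloid_hom = source: poloid P m + target: poloid Q n
  for P :: "'a set" and m and Q :: "'b set" and n +
  fixes \<phi> :: "'a \<Rightarrow> 'b"
  assumes hom_carrier: "\<And>x. x \<in> P \<Longrightarrow> \<phi> x \<in> Q"
    and hom_mult: "\<And>x y z. m x y = Some z \<Longrightarrow> n (\<phi> x) (\<phi> y) = Some (\<phi> z)"
    and hom_unit: "\<And>e. source.is_unit_elem e \<Longrightarrow> target.is_unit_elem (\<phi> e)"

locale poloid_iso = poloid_hom P m Q n \<phi>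
  for P :: "'a set" and m and Q :: "'b set" and n and \<phi> +
  assumes iso_bij: "bij_betw \<phi> P Q"
    and iso_inverse_hom: "poloid_hom Q n P m (inv_into P \<phi>)"


text \<open>
  A transformation is given by its rule, a partial map carrying its own domain, together with its
  codomain. Equality is thus equality of domains, values and codomains.
\<close>

datatype 'x transformation = Transformation (rule_of: "'x \<rightharpoonup> 'x") (tcod: "'x set")

definition tdom :: "'x transformation \<Rightarrow> 'x set" where
  "tdom f = dom (rule_of f)"

definition tim :: "'x transformation \<Rightarrow> 'x set" where
  "tim f = ran (rule_of f)"

definition transformation_on :: "'x set \<Rightarrow> 'x transformation \<Rightarrow> bool" where
  "transformation_on X f \<longleftrightarrow> tdom f \<subseteq> X \<and> tcod f \<subseteq> X \<and> tim f \<subseteq> tcod f"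

definition identity_transformation :: "'x set \<Rightarrow> 'x transformation" where
  "identity_transformation S = Transformation (Some |` S) S"

text \<open>
  This is the composite only when \<open>tim g \<subseteq> tdom f\<close>; for other arguments its value is irrelevant,
  since the operation \<open>transformation_mult\<close> below is undefined there.
\<close>

definition transformation_comp ::
    "'x transformation \<Rightarrow> 'x transformation \<Rightarrow> 'x transformation" where
  "transformation_comp f g = Transformation (rule_of f \<circ>\<^sub>m rule_of g) (tcod f)"

lemma tcod_transformation_comp: "tcod (transformation_comp f g) = tcod f"
  by (simp add: transformation_comp_def)

lemma tdom_transformation_comp:
  assumes "tim g \<subseteq> tdom f"
  shows "tdom (transformation_comp f g) = tdom g"
  using assms
  by (fastforce simp: tdom_def tim_def transformation_comp_def map_comp_def ran_def
      split: option.splits)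

definition transformation_mult ::
    "'x transformation set \<Rightarrow> 'x transformation \<Rightarrow> 'x transformation \<Rightarrow> 'x transformation option"
  where
  "transformation_mult F f g =
     (if f \<in> F \<and> g \<in> F \<and> tim g \<subseteq> tdom f then Some (transformation_comp f g) else None)"

locale transformation_magma = partial_magma F "transformation_mult F"
  for F :: "'x transformation set" +
  fixes X :: "'x set"
  assumes transformations: "\<And>f. f \<in> F \<Longrightarrow> transformation_on X f"
    and transformations_nonempty: "\<And>f. f \<in> F \<Longrightarrow> tdom f \<noteq> {}"

locale transformation_semigroupoid = transformation_magma +
  assumes dom_eq_cod: "\<And>f g. \<lbrakk>f \<in> F; g \<in> F; tim g \<subseteq> tdom f\<rbrakk> \<Longrightarrow> tdom f = tcod g"

locale transformation_poloid = transformation_semigroupoid +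
  assumes identity_dom: "\<And>f. f \<in> F \<Longrightarrow> identity_transformation (tdom f) \<in> F"
    and identity_cod: "\<And>f. f \<in> F \<Longrightarrow> identity_transformation (tcod f) \<in> F"

end

theory Submission
  imports Defs
begin

text \<open>
  As in Cayley's theorem, \<open>x\<close> is represented by left multiplication \<open>y \<mapsto> xy\<close>, whose domain is the
  set of all \<open>y\<close> with \<open>xy\<close> defined; its codomain is the set of all \<open>z\<close> with \<open>ez\<close> defined, where
  \<open>e\<close> is the left unit of \<open>x\<close>. Since \<open>y = y\<epsilon>\<close> lies in the image of left multiplication by \<open>y\<close>, the
  image is contained in the domain of left multiplication by \<open>x\<close> exactly if \<open>xy\<close> is defined. In
  that case the right unit of \<open>x\<close> is the left unit of \<open>y\<close>, so that domain and codomain agree.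
\<close>

section \<open>Associativity in semigroupoids\<close>

context semigroupoid
begin

text \<open>Condition (a) of the semigroupoid axiom as an elimination rule; the next two lemmas do
  the same for (b) and (c). The arguments about left translations then avoid
  \<open>Option.bind\<close>.\<close>

lemma assoc_if_products:
  assumes "m x y = Some u" "m y z = Some v"
  obtains w where "m u z = Some w" "m x v = Some w"
proof -
  have "x \<in> P" "y \<in> P" "z \<in> P"
    using assms m_closed by blast+
  then have "left_assoc x y z \<noteq> None \<and> left_assoc x y z = right_assoc x y z"
    using semigroupoid_assoc assms by blast
  then have "m u z \<noteq> None \<and> m u z = m x v"
    unfolding left_assoc_def right_assoc_def assms bind.bind_lunit .
  then show ?thesis
    by (metis that option.exhaust)
qed

lemma assoc_if_right:
  assumes "m y z = Some v" "m x v = Some w"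
  obtains u where "m x y = Some u" "m u z = Some w"
proof -
  have "x \<in> P" "y \<in> P" "z \<in> P"
    using assms m_closed by blast+
  moreover have "right_assoc x y z = Some w"
    by (simp add: right_assoc_def assms)
  ultimately have "left_assoc x y z = Some w"
    using semigroupoid_assoc by (metis option.distinct(1))
  then show ?thesis
    using that by (auto simp: left_assoc_def bind_eq_Some_conv)
qed

lemma assoc_if_left:
  assumes "m x y = Some u" "m u z = Some w"
  obtains v where "m y z = Some v" "m x v = Some w"
proof -
  have "x \<in> P" "y \<in> P" "z \<in> P"
    using assms m_closed by blast+
  moreover have "left_assoc x y z = Some w"
    by (simp add: left_assoc_def assms)
  ultimately have "right_assoc x y z = Some w"
    using semigroupoid_assoc by (metis option.distinct(1))
  then show ?thesis
    using that by (auto simp: right_assoc_def bind_eq_Some_conv)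
qed

end

section \<open>Units in magmas\<close>

context partial_magma
begin

lemma left_unit_eq:
  assumes "is_unit_elem e" "m e x = Some y"
  shows "y = x"
proof -
  have "x \<in> P"
    using assms(2) m_closed by blast
  with assms have "m e x = Some x"
    unfolding is_unit_elem_def by blast
  with assms(2) show ?thesis
    by simp
qed

lemma right_unit_eq:
  assumes "is_unit_elem e" "m x e = Some y"
  shows "y = x"
proof -
  have "x \<in> P"
    using assms(2) m_closed by blast
  with assms have "m x e = Some x"
    unfolding is_unit_elem_def by blast
  with assms(2) show ?thesis
    by simp
qed

end

section \<open>Units of poloids and the representation by left translations\<close>

context poloid
begin

lemma left_unit_obtain:
  assumes "x \<in> P"
  obtains e where "is_unit_elem e" "m e x = Some x"
proof -
  obtain e where "is_unit_elem e" "m e x \<noteq> None"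
    using poloid_units[OF assms] by blast
  with assms that show ?thesis
    unfolding is_unit_elem_def by blast
qed

lemma right_unit_obtain:
  assumes "x \<in> P"
  obtains e where "is_unit_elem e" "m x e = Some x"
proof -
  obtain e where "is_unit_elem e" "m x e \<noteq> None"
    using poloid_units[OF assms] by blast
  with assms that show ?thesis
    unfolding is_unit_elem_def by blast
qed

text \<open>A left unit \<open>e'\<close> of \<open>e\<close> satisfies \<open>e'e = e\<close>,
  while \<open>e\<close> as a unit on the right forces \<open>e'e = e'\<close>.\<close>

lemma unit_idem:
  assumes "is_unit_elem e"
  shows "m e e = Some e"
proof -
  have "e \<in> P"
    using assms by (simp add: is_unit_elem_def)
  then obtain e' where "is_unit_elem e'" "m e' e = Some e"
    by (rule left_unit_obtain)
  moreover from this assms have "e = e'"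
    using right_unit_eq by blast
  ultimately show ?thesis
    by simp
qed

text \<open>Quantifying over left units avoids choosing one; by \<open>dom_eq_left_codomain\<close>,
  every left unit \<open>e\<close> of \<open>x\<close> gives the same set
  \<open>dom (m e)\<close>.\<close>

definition left_codomain :: "'a \<Rightarrow> 'a set" where
  "left_codomain x = {z. \<exists>e. is_unit_elem e \<and> m e x \<noteq> None \<and> m e z \<noteq> None}"

definition left_translation :: "'a \<Rightarrow> 'a transformation" where
  "left_translation x = Transformation (m x) (left_codomain x)"

lemma tdom_left_translation: "tdom (left_translation x) = dom (m x)"
  by (simp add: tdom_def left_translation_def)

lemma tim_left_translation: "tim (left_translation x) = ran (m x)"
  by (simp add: tim_def left_translation_def)

lemma tcod_left_translation: "tcod (left_translation x) = left_codomain x"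
  by (simp add: left_translation_def)

lemma self_in_ran: "x \<in> P \<Longrightarrow> x \<in> ran (m x)"
  by (metis right_unit_obtain ranI)

text \<open>Turns composability of translations into definedness of a product. One direction tests
  the inclusion at \<open>y\<close>; in the other, \<open>xy\<close> and \<open>yz\<close> being
  defined makes \<open>x(yz)\<close> defined.\<close>

lemma ran_subset_dom_iff:
  assumes "y \<in> P"
  shows "ran (m y) \<subseteq> dom (m x) \<longleftrightarrow> m x y \<noteq> None"
proof
  assume "ran (m y) \<subseteq> dom (m x)"
  with self_in_ran[OF assms] show "m x y \<noteq> None"
    by blast
next
  assume "m x y \<noteq> None"
  then obtain u where u: "m x y = Some u"
    by blast
  show "ran (m y) \<subseteq> dom (m x)"
  proof
    fix v
    assume "v \<in> ran (m y)"
    then obtain z where "m y z = Some v"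
      by (auto simp: ran_def)
    with u obtain w where "m x v = Some w"
      by (rule assoc_if_products)
    then show "v \<in> dom (m x)"
      by blast
  qed
qed

text \<open>If \<open>xy\<close> is defined, then so is \<open>(xr)y\<close>, hence
  \<open>ry\<close>. Conversely, \<open>xr\<close> and \<open>ry\<close> being defined makes
  \<open>x(ry) = xy\<close> defined.\<close>

lemma dom_eq_dom_right_unit:
  assumes "is_unit_elem r" "m x r = Some x"
  shows "dom (m x) = dom (m r)"
proof (intro equalityI subsetI)
  fix y
  assume "y \<in> dom (m x)"
  then obtain w where "m x y = Some w"
    by blast
  with assms(2) obtain v where "m r y = Some v"
    by (rule assoc_if_left)
  then show "y \<in> dom (m r)"
    by blast
next
  fix y
  assume "y \<in> dom (m r)"
  then have "m r y = Some y"
    using assms(1) left_unit_eq by blast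
  with assms(2) obtain w where "m x y = Some w"
    by (rule assoc_if_products)
  then show "y \<in> dom (m x)"
    by blast
qed

text \<open>The right units of \<open>x\<close> are exactly the left units of \<open>y\<close>, and
  left multiplication by any of them has the same domain as left multiplication by
  \<open>x\<close>.\<close>

lemma dom_eq_left_codomain:
  assumes xy: "m x y = Some u"
  shows "dom (m x) = left_codomain y"
proof -
  have "x \<in> P"
    using xy m_closed by blast
  then obtain r where r: "is_unit_elem r" "m x r = Some x"
    by (rule right_unit_obtain)
  note dom = dom_eq_dom_right_unit[OF r]
  show ?thesis
  proof (intro equalityI subsetI)
    fix z
    assume "z \<in> dom (m x)"
    moreover have "y \<in> dom (m x)"
      using xy by blast
    ultimately have "m r y \<noteq> None" "m r z \<noteq> None"
      unfolding dom by blast+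
    with r(1) show "z \<in> left_codomain y"
      unfolding left_codomain_def by blast
  next
    fix z
    assume "z \<in> left_codomain y"
    then obtain e where e: "is_unit_elem e" "m e y = Some y" "m e z = Some z"
      using left_unit_eq by (fastforce simp: left_codomain_def)
    \<comment> \<open>Reading \<open>y\<close> as \<open>ey\<close> makes \<open>xy\<close> the
      product \<open>x(ey)\<close>, so \<open>xe\<close> is defined.\<close>
    from e(2) xy obtain x' where "m x e = Some x'"
      by (rule assoc_if_right)
    then have "m x e = Some x"
      using e(1) right_unit_eq by blast
    with e dom_eq_dom_right_unit[of e x] show "z \<in> dom (m x)"
      by blast
  qed
qed

lemma left_codomain_subset: "left_codomain x \<subseteq> P"
  using m_closed by (auto simp: left_codomain_def)

lemma ran_subset_left_codomain:
  assumes "x \<in> P"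
  shows "ran (m x) \<subseteq> left_codomain x"
proof -
  obtain l where l: "m l x = Some x"
    using assms left_unit_obtain by blast
  then have "ran (m x) \<subseteq> dom (m l)"
    by (simp add: ran_subset_dom_iff[OF assms])
  with dom_eq_left_codomain[OF l] show ?thesis
    by simp
qed

lemma left_codomain_mult:
  assumes "m x y = Some u"
  shows "left_codomain u = left_codomain x"
proof -
  have "x \<in> P"
    using assms m_closed by blast
  then obtain l where l: "is_unit_elem l" "m l x = Some x"
    by (rule left_unit_obtain)
  \<comment> \<open>The left unit \<open>l\<close> of \<open>x\<close> also multiplies
    \<open>u = xy\<close>, so both codomains are \<open>dom (m l)\<close>.\<close>
  from l(2) assms obtain v where "m l u = Some v"
    by (rule assoc_if_products)
  with dom_eq_left_codomain[OF l(2)] show ?thesis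
    using dom_eq_left_codomain by blast
qed

text \<open>Associativity read pointwise. Equality of partial maps also requires \<open>uz\<close>
  to be undefined wherever \<open>yz\<close> is, which follows from condition (c).\<close>

lemma map_comp_mult:
  assumes "m x y = Some u"
  shows "m u = m x \<circ>\<^sub>m m y"
proof
  fix z
  show "m u z = (m x \<circ>\<^sub>m m y) z"
  proof (cases "m y z")
    case None
    have "m u z = None"
    proof (rule ccontr)
      assume "m u z \<noteq> None"
      then obtain w where "m u z = Some w"
        by blast
      with assms obtain v where "m y z = Some v"
        by (rule assoc_if_left)
      with None show False
        by simp
    qed
    with None show ?thesis
      by (simp add: map_comp_def)
  next
    case (Some v)
    with assms obtain w where "m u z = Some w" "m x v = Some w"
      by (rule assoc_if_products)
    with Some show ?thesis
      by simp
  qed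
qed

lemma left_translation_mult:
  "m x y = Some u \<Longrightarrow>
    left_translation u = transformation_comp (left_translation x) (left_translation y)"
  by (simp add: left_translation_def transformation_comp_def map_comp_mult left_codomain_mult)

lemma transformation_mult_left_translation:
  assumes "x \<in> P" "y \<in> P"
  shows "transformation_mult (left_translation ` P) (left_translation x) (left_translation y)
    = map_option left_translation (m x y)"
  using assms
  by (cases "m x y")
    (simp_all add: transformation_mult_def tdom_left_translation tim_left_translation
      ran_subset_dom_iff left_translation_mult)

text \<open>Evaluation at a right unit \<open>r\<close> of \<open>x\<close> recovers the element:
  \<open>yr = xr = x\<close>, and \<open>yr\<close> can only be \<open>y\<close>.\<close>

lemma inj_on_left_translation: "inj_on left_translation P"
proof (rule inj_onI)
  fix x y
  assume "x \<in> P" "y \<in> P" "left_translation x = left_translation y"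
  then have eq: "m x = m y"
    by (simp add: left_translation_def)
  obtain r where "is_unit_elem r" "m x r = Some x"
    using \<open>x \<in> P\<close> by (rule right_unit_obtain)
  with eq show "x = y"
    using right_unit_eq by auto
qed

text \<open>Applying \<open>dom_eq_left_codomain\<close> to \<open>ee = e\<close> makes domain and
  codomain coincide. Units thus supply the identities that a transformation poloid must
  contain.\<close>

lemma left_translation_unit:
  assumes "is_unit_elem e"
  shows "left_translation e = identity_transformation (dom (m e))"
proof -
  have "m e = Some |` dom (m e)"
    using assms left_unit_eq by (force simp: restrict_map_def)
  moreover have "left_codomain e = dom (m e)"
    using unit_idem[OF assms] dom_eq_left_codomain by blast
  ultimately show ?thesis
    by (simp add: left_translation_def identity_transformation_def)
qed

text \<open>Transport of structure: \<open>mult\<close> preserves and reflects definedness through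
  \<open>map_option\<close>, and \<open>closed\<close> excludes products outside the image.\<close>

lemma poloid_iso_transport:
  assumes inj: "inj_on \<phi> P"
    and closed: "\<And>a b c. n a b = Some c \<Longrightarrow> a \<in> \<phi> ` P \<and> b \<in> \<phi> ` P"
    and mult: "\<And>x y. x \<in> P \<Longrightarrow> y \<in> P \<Longrightarrow> n (\<phi> x) (\<phi> y) = map_option \<phi> (m x y)"
  shows "poloid_iso P m (\<phi> ` P) n \<phi>"
proof -
  have n_SomeE: "\<exists>x y z. a = \<phi> x \<and> b = \<phi> y \<and> c = \<phi> z \<and> m x y = Some z"
    if abc: "n a b = Some c" for a b c
  proof -
    obtain x y where xy: "x \<in> P" "y \<in> P" "a = \<phi> x" "b = \<phi> y"
      using closed[OF abc] by blast
    with abc mult obtain z where "m x y = Some z" "c = \<phi> z"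
      by auto
    with xy show ?thesis
      by blast
  qed
  interpret T: partial_magma "\<phi> ` P" n
  proof
    show "\<phi> ` P \<noteq> {}"
      using carrier_nonempty by blast
    show "a \<in> \<phi> ` P \<and> b \<in> \<phi> ` P \<and> c \<in> \<phi> ` P" if "n a b = Some c" for a b c
      using n_SomeE[OF that] m_closed by blast
    obtain x y z where "m x y = Some z"
      using m_nonempty by blast
    with m_closed mult have "n (\<phi> x) (\<phi> y) = Some (\<phi> z)"
      by (metis option.simps(9))
    then show "\<exists>a b. n a b \<noteq> None"
      by blast
  qed
  have left: "T.left_assoc (\<phi> x) (\<phi> y) (\<phi> z) = map_option \<phi> (left_assoc x y z)"
    and right: "T.right_assoc (\<phi> x) (\<phi> y) (\<phi> z) = map_option \<phi> (right_assoc x y z)"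
    if "x \<in> P" "y \<in> P" "z \<in> P" for x y z
    using that mult m_closed
    by (auto simp: T.left_assoc_def T.right_assoc_def left_assoc_def right_assoc_def
        split: Option.bind_splits)
  \<comment> \<open>Injectivity reflects the unit laws back to \<open>P\<close>, so that the inverse
    map preserves units.\<close>
  have unit: "T.is_unit_elem (\<phi> e) \<longleftrightarrow> is_unit_elem e" if "e \<in> P" for e
  proof -
    have "map_option \<phi> (m x y) = Some (\<phi> z) \<longleftrightarrow> m x y = Some z" if "z \<in> P" for x y z
      using that inj m_closed by (auto dest: inj_onD)
    with that mult show ?thesis
      by (auto simp: T.is_unit_elem_def is_unit_elem_def)
  qed
  interpret T: poloid "\<phi> ` P" n
  proof
    fix a b c
    assume "a \<in> \<phi> ` P" "b \<in> \<phi> ` P" "c \<in> \<phi> ` P"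
      and hyp: "n a b \<noteq> None \<and> n b c \<noteq> None \<or> T.right_assoc a b c \<noteq> None
        \<or> T.left_assoc a b c \<noteq> None"
    then obtain x y z where "x \<in> P" "y \<in> P" "z \<in> P" "a = \<phi> x" "b = \<phi> y" "c = \<phi> z"
      by blast
    with hyp semigroupoid_assoc[of x y z]
    show "T.left_assoc a b c \<noteq> None \<and> T.right_assoc a b c \<noteq> None
        \<and> T.left_assoc a b c = T.right_assoc a b c"
      by (auto simp: left right mult)
  next
    fix a
    assume "a \<in> \<phi> ` P"
    then obtain x where x: "x \<in> P" "a = \<phi> x"
      by blast
    obtain e e' where "is_unit_elem e" "is_unit_elem e'" "m e x \<noteq> None" "m x e' \<noteq> None"
      using poloid_units[OF x(1)] by blast
    moreover from this have "e \<in> P" "e' \<in> P"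
      by (simp_all add: is_unit_elem_def)
    ultimately have "T.is_unit_elem (\<phi> e)" "T.is_unit_elem (\<phi> e')"
      "n (\<phi> e) a \<noteq> None" "n a (\<phi> e') \<noteq> None"
      using x by (simp_all add: unit mult)
    then show "\<exists>e e'. T.is_unit_elem e \<and> T.is_unit_elem e' \<and> n e a \<noteq> None \<and> n a e' \<noteq> None"
      by blast
  qed
  have hom: "poloid_hom P m (\<phi> ` P) n \<phi>"
  proof
    show "\<phi> x \<in> \<phi> ` P" if "x \<in> P" for x
      using that by blast
    show "n (\<phi> x) (\<phi> y) = Some (\<phi> z)" if "m x y = Some z" for x y z
      using that m_closed[OF that] by (simp add: mult)
    show "T.is_unit_elem (\<phi> e)" if "is_unit_elem e" for e
      using that unit by (auto simp: is_unit_elem_def)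
  qed
  have inv: "poloid_hom (\<phi> ` P) n P m (inv_into P \<phi>)"
  proof
    show "inv_into P \<phi> a \<in> P" if "a \<in> \<phi> ` P" for a
      using that by (rule inv_into_into)
    show "m (inv_into P \<phi> a) (inv_into P \<phi> b) = Some (inv_into P \<phi> c)"
      if abc: "n a b = Some c" for a b c
    proof -
      obtain x y z where "a = \<phi> x" "b = \<phi> y" "c = \<phi> z" "m x y = Some z"
        using n_SomeE[OF abc] by blast
      with m_closed[of x y z] inj show ?thesis
        by (simp add: inv_into_f_f)
    qed
    show "is_unit_elem (inv_into P \<phi> a)" if "T.is_unit_elem a" for a
    proof -
      obtain e where "e \<in> P" "a = \<phi> e"
        using \<open>T.is_unit_elem a\<close> by (auto simp: T.is_unit_elem_def)
      with that inj unit show ?thesis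
        by (simp add: inv_into_f_f)
    qed
  qed
  show ?thesis
    by (intro poloid_iso.intro poloid_iso_axioms.intro hom inv inj_on_imp_bij_betw inj)
qed

lemma poloid_iso_left_translation:
  "poloid_iso P m (left_translation ` P) (transformation_mult (left_translation ` P))
     left_translation"
  using inj_on_left_translation
proof (rule poloid_iso_transport)
  fix f g h
  assume "transformation_mult (left_translation ` P) f g = Some h"
  then show "f \<in> left_translation ` P \<and> g \<in> left_translation ` P"
    by (auto simp: transformation_mult_def split: if_splits)
qed (rule transformation_mult_left_translation)

lemma transformation_poloid_left_translation:
  "transformation_poloid (left_translation ` P) P"
proof -
  \<comment> \<open>The target of this isomorphism supplies the magma axioms; only the conditions on
    transformations remain.\<close>
  interpret iso: poloid_iso P m "left_translation ` P"
      "transformation_mult (left_translation ` P)" left_translation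
    by (rule poloid_iso_left_translation)
  show ?thesis
  proof
    fix f
    assume "f \<in> left_translation ` P"
    then obtain x where x: "x \<in> P" "f = left_translation x"
      by blast
    obtain r where r: "is_unit_elem r" "m x r = Some x"
      using x(1) by (rule right_unit_obtain)
    obtain l where l: "is_unit_elem l" "m l x = Some x"
      using x(1) by (rule left_unit_obtain)
    have "dom (m x) \<subseteq> P"
      using m_closed by blast
    then show "transformation_on P f"
      using x left_codomain_subset ran_subset_left_codomain
      by (simp add: transformation_on_def tdom_left_translation tim_left_translation
          tcod_left_translation)
    show "tdom f \<noteq> {}"
      using x r by (auto simp: tdom_left_translation)
    \<comment> \<open>The right unit \<open>r\<close> yields the identity on the domain, and below
      the left unit \<open>l\<close> yields the one on the codomain.\<close>
    have "identity_transformation (tdom f) = left_translation r"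
      using x r by (simp add: tdom_left_translation dom_eq_dom_right_unit left_translation_unit)
    with r show "identity_transformation (tdom f) \<in> left_translation ` P"
      by (simp add: is_unit_elem_def)
    have "identity_transformation (tcod f) = left_translation l"
      using x l
      by (simp add: tcod_left_translation dom_eq_left_codomain[symmetric] left_translation_unit)
    with l show "identity_transformation (tcod f) \<in> left_translation ` P"
      by (simp add: is_unit_elem_def)
  next
    fix f g
    assume "f \<in> left_translation ` P" "g \<in> left_translation ` P" "tim g \<subseteq> tdom f"
    then obtain x y u where "f = left_translation x" "g = left_translation y"
        and u: "m x y = Some u"
      by (auto simp: tdom_left_translation tim_left_translation ran_subset_dom_iff)
    then show "tdom f = tcod g"
      by (simp add: tdom_left_translation tcod_left_translation dom_eq_left_codomain[OF u])
  qed
qed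

end

theorem corollary1:
  fixes P :: "'a set" and m :: "'a \<Rightarrow> 'a \<Rightarrow> 'a option"
  assumes "poloid P m"
  shows "\<exists>(X :: 'a set) (F :: 'a transformation set) (\<phi> :: 'a \<Rightarrow> 'a transformation).
           X \<noteq> {} \<and> transformation_poloid F X \<and>
           poloid_iso P m F (transformation_mult F) \<phi>"
proof -
  interpret poloid P m
    by (rule assms)
  show ?thesis
    using carrier_nonempty transformation_poloid_left_translation poloid_iso_left_translation
    by blast
qed

end
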